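(* Let $S$ and $T$ be standard Borel spaces, let $P$ be a stochastic effectivity function from $S$ to $S$ and $Q$ a stochastic effectivity function from $T$ to $T$, and let $f:P\to Q$ be a strong morphism. Let $G=\{\langle s,f(s)\rangle : s \in S\}$ be the graph of $f$ and $G^{-1}=\{\langle f(s),s\rangle : s\in S\}$ its converse relation. Then the relation $R := G\cup G^{-1}$ is a state bisimulation on the direct sum $P\oplus Q$.
   Context: For a measurable space $S$, $\mathbb{S}(S)$ denotes the set of subprobability measures on $S$ with the weak-* $\sigma$-algebra $w(S)$ generated by the sets $\{\mu : \mu(A)\bowtie q\}$ ($A$ measurable, $q\in[0,1]$, $\bowtie\in\{\le,<,\ge,>\}$). For measurable $f:S\to T$, $\mathbb{S}f:\mathbb{S}(S)\to\mathbb{S}(T)$ is the image-measure map $(\mathbb{S}f)(\mu)(B)=\mu(f^{-1}[B])$. A stochastic effectivity function from $S$ to $S$ is a map $P$ assigning to each $s\in S$ an upper closed subset $P(s)$ of $w(S)$ (i.e. $A\in P(s)$, $A\subseteq B\in w(S)$ imply $B\in P(s)$) which is t-measurable: for every measurable $H\subseteq \mathbb{S}(S)\times[0,1]$ (w.r.t. $w(S)\otimes$ Borel sets of $[0,1]$), the set $\{\langle s,q\rangle : H_q\in P(s)\}$ is measurable in $S\times[0,1]$, where $H_q=\{\mu:\langle\mu,q\rangle\in H\}$. A measurable map $f:S\to T$ is a strong morphism from $P$ to $Q$ if $f$ is surjective and for all $s\in S$ and all $A\in w(S)$: $A\in P(s)$ iff $(\mathbb{S}f)^{-1}[B]\subseteq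 A$ for some $B\in Q(f(s))$. For disjoint $S,T$, the direct sum $P\oplus Q$ is the effectivity function on the disjoint union (coproduct measurable space) $S\oplus T$ given by $(P\oplus Q)(x)=P(x)$ for $x\in S$ and $=Q(x)$ for $x\in T$. For a binary relation $R$ on a measurable space $X$, a set is $R$-closed if $x$ in it and $x\,R\,y$ imply $y$ in it; for measures $\mu,\mu'$ on $X$ write $\mu\,\bar R\,\mu'$ if they agree on all measurable $R$-closed sets. A relation $R$ on $X$ is a state bisimulation on an effectivity function $P$ on $X$ if it is symmetric and whenever $s\,R\,t$, for each $A\in P(s)$ there is $B\in P(t)$ such that for every $\nu\in B$ there exists $\mu\in A$ with $\mu\,\bar R\,\nu$. *)

theory Defs
  imports "HOL-Probability.Probability"
begin

text \<open>
  A value of type \<open>'a measure\<close> used as a measurable space contributes only its carrier and its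
  \<open>\<sigma>\<close>-algebra; the measure it carries is irrelevant.

  The space of subprobabilities with the weak-* \<open>\<sigma>\<close>-algebra is \<^const>\<open>subprob_algebra\<close>, whose
  \<open>\<sigma>\<close>-algebra is generated by the evaluations at measurable sets. Over an empty space it
  contains no measure, not even the zero measure; as effectivity functions are only evaluated at
  points of the state space, nothing below depends on this.
\<close>

definition standard_borel :: "'a measure \<Rightarrow> bool" where
  "standard_borel S \<longleftrightarrow>
     (\<exists>X. completely_metrizable_space X \<and> separable_space X \<and>
          topspace X = space S \<and> sets S = sigma_sets (topspace X) {U. openin X U})"

abbreviation unit_interval :: "real measure" where
  "unit_interval \<equiv> restrict_space borel {0..1}"

definition t_measurable :: "'a measure \<Rightarrow> ('a \<Rightarrow> 'a measure set set) \<Rightarrow> bool" where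
  "t_measurable S P \<longleftrightarrow>
     (\<forall>H \<in> sets (subprob_algebra S \<Otimes>\<^sub>M unit_interval).
        {(s, q). s \<in> space S \<and> q \<in> {0..1} \<and> {\<mu>. (\<mu>, q) \<in> H} \<in> P s}
          \<in> sets (S \<Otimes>\<^sub>M unit_interval))"

definition stochastic_effectivity :: "'a measure \<Rightarrow> ('a \<Rightarrow> 'a measure set set) \<Rightarrow> bool" where
  "stochastic_effectivity S P \<longleftrightarrow>
     (\<forall>s \<in> space S. P s \<subseteq> sets (subprob_algebra S) \<and>
        (\<forall>A \<in> P s. \<forall>B \<in> sets (subprob_algebra S). A \<subseteq> B \<longrightarrow> B \<in> P s)) \<and>
     t_measurable S P"

definition strong_morphism ::
  "'a measure \<Rightarrow> ('a \<Rightarrow> 'a measure set set) \<Rightarrow> 'b measure \<Rightarrow> ('b \<Rightarrow> 'b measure set set) \<Rightarrow>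
   ('a \<Rightarrow> 'b) \<Rightarrow> bool" where
  "strong_morphism S P T Q f \<longleftrightarrow>
     f \<in> S \<rightarrow>\<^sub>M T \<and> f ` space S = space T \<and>
     (\<forall>s \<in> space S. \<forall>A \<in> sets (subprob_algebra S).
        A \<in> P s \<longleftrightarrow>
        (\<exists>B \<in> Q (f s). (\<lambda>\<mu>. distr \<mu> T f) -` B \<inter> space (subprob_algebra S) \<subseteq> A))"

definition sum_space :: "'a measure \<Rightarrow> 'b measure \<Rightarrow> ('a + 'b) measure" where
  "sum_space S T = sigma (space S <+> space T) {A <+> B | A B. A \<in> sets S \<and> B \<in> sets T}"

text \<open>
  A subprobability on a summand is regarded as one on the sum via its image under the injection.
  The images of the members of \<open>P s\<close> do not form an upper closed family in the subprobabilities on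
  the sum, so the direct sum takes the upper closure.
\<close>

definition direct_sum ::
  "'a measure \<Rightarrow> ('a \<Rightarrow> 'a measure set set) \<Rightarrow> 'b measure \<Rightarrow> ('b \<Rightarrow> 'b measure set set) \<Rightarrow>
   'a + 'b \<Rightarrow> ('a + 'b) measure set set" where
  "direct_sum S P T Q x = {A \<in> sets (subprob_algebra (sum_space S T)).
     case x of
       Inl s \<Rightarrow> \<exists>D \<in> P s. (\<lambda>\<mu>. distr \<mu> (sum_space S T) Inl) ` D \<subseteq> A
     | Inr t \<Rightarrow> \<exists>D \<in> Q t. (\<lambda>\<mu>. distr \<mu> (sum_space S T) Inr) ` D \<subseteq> A}"

definition rel_closed :: "('a \<times> 'a) set \<Rightarrow> 'a set \<Rightarrow> bool" where
  "rel_closed R C \<longleftrightarrow> (\<forall>x y. x \<in> C \<longrightarrow> (x, y) \<in> R \<longrightarrow> y \<in> C)"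

definition rel_lift :: "'a measure \<Rightarrow> ('a \<times> 'a) set \<Rightarrow> 'a measure \<Rightarrow> 'a measure \<Rightarrow> bool" where
  "rel_lift X R \<mu> \<mu>' \<longleftrightarrow> (\<forall>C \<in> sets X. rel_closed R C \<longrightarrow> emeasure \<mu> C = emeasure \<mu>' C)"

definition state_bisimulation ::
  "'a measure \<Rightarrow> ('a \<Rightarrow> 'a measure set set) \<Rightarrow> ('a \<times> 'a) set \<Rightarrow> bool" where
  "state_bisimulation X P R \<longleftrightarrow>
     R \<subseteq> space X \<times> space X \<and> sym R \<and>
     (\<forall>(s, t) \<in> R. \<forall>A \<in> P s. \<exists>B \<in> P t. \<forall>\<nu> \<in> B. \<exists>\<mu> \<in> A. rel_lift X R \<mu> \<nu>)"


text \<open>Sanity checks: \<^const>\<open>sum_space\<close> is the coproduct and \<^const>\<open>direct_sum\<close> yields an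
  effectivity function.\<close>

lemma space_sum_space: "space (sum_space S T) = space S <+> space T"
  unfolding sum_space_def by (auto dest: sets.sets_into_space intro!: space_measure_of)

lemma sets_sum_space: "sets (sum_space S T) = {A <+> B | A B. A \<in> sets S \<and> B \<in> sets T}"
proof -
  let ?G = "{A <+> B | A B. A \<in> sets S \<and> B \<in> sets T}"
  have "sigma_algebra (space S <+> space T) ?G"
    unfolding sigma_algebra_iff2
  proof (intro conjI ballI allI impI)
    show "?G \<subseteq> Pow (space S <+> space T)" by (auto dest: sets.sets_into_space)
    have "({}::('a+'b) set) = {} <+> {}" by auto
    then show "{} \<in> ?G" by blast
  next
    fix C assume "C \<in> ?G"
    then obtain A B where "C = A <+> B" "A \<in> sets S" "B \<in> sets T" by blast
    moreover have "(space S <+> space T) - (A <+> B) = (space S - A) <+> (space T - B)" by auto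
    ultimately show "(space S <+> space T) - C \<in> ?G" by blast
  next
    fix F :: "nat \<Rightarrow> ('a + 'b) set" assume "range F \<subseteq> ?G"
    then have "\<forall>i. \<exists>A B. F i = A <+> B \<and> A \<in> sets S \<and> B \<in> sets T" by blast
    then obtain A B where F: "\<And>i. F i = A i <+> B i" "\<And>i. A i \<in> sets S" "\<And>i. B i \<in> sets T"
      by metis
    then have "(\<Union>i. F i) = (\<Union>i. A i) <+> (\<Union>i. B i)" by auto
    moreover have "(\<Union>i. A i) \<in> sets S" "(\<Union>i. B i) \<in> sets T" using F by auto
    ultimately show "(\<Union>i. F i) \<in> ?G" by blast
  qed
  then show ?thesis
    unfolding sum_space_def
    by (subst sets_measure_of) (auto simp: sigma_algebra.sigma_sets_eq dest: sets.sets_into_space)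
qed

lemma sets_sum_space_iff:
  "C \<in> sets (sum_space S T) \<longleftrightarrow> Inl -` C \<in> sets S \<and> Inr -` C \<in> sets T"
proof -
  have "C = (Inl -` C) <+> (Inr -` C)"
    by (auto simp: Plus_def image_iff) (metis sumE)
  moreover have "Inl -` (A <+> B) = A" "Inr -` (A <+> B) = B"
    for A :: "'a set" and B :: "'b set" by auto
  ultimately show ?thesis unfolding sets_sum_space by (smt (verit) mem_Collect_eq)
qed

lemma measurable_Inl_sum_space [measurable]: "Inl \<in> S \<rightarrow>\<^sub>M sum_space S T"
  by (rule measurableI) (auto simp: space_sum_space sets_sum_space_iff intro: sets.Int)

lemma measurable_Inr_sum_space [measurable]: "Inr \<in> T \<rightarrow>\<^sub>M sum_space S T"
  by (rule measurableI) (auto simp: space_sum_space sets_sum_space_iff intro: sets.Int)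

lemma image_Inl_times_measurable:
  fixes S :: "'a measure" and T :: "'b measure"
  assumes "E \<in> sets (S \<Otimes>\<^sub>M N)"
  shows "{(x, q). \<exists>s. x = Inl s \<and> (s, q) \<in> E} \<in> sets (sum_space S T \<Otimes>\<^sub>M N)"
proof (cases "space S = {}")
  case True
  then have "E = {}" using sets.sets_into_space[OF assms] by (auto simp: space_pair_measure)
  then show ?thesis by simp
next
  case False
  then obtain s0 where s0: "s0 \<in> space S" by blast
  let ?g = "\<lambda>x. case x of Inl s \<Rightarrow> s | Inr t \<Rightarrow> s0"
  let ?L = "(Inl ` space S :: ('a + 'b) set)"
  have g: "?g \<in> sum_space S T \<rightarrow>\<^sub>M S"
  proof (rule measurableI)
    show "?g x \<in> space S" if "x \<in> space (sum_space S T)" for x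
      using that s0 by (auto simp: space_sum_space)
    fix A assume A: "A \<in> sets S"
    have "?g -` A \<inter> space (sum_space S T) = A <+> (if s0 \<in> A then space T else {})"
      using sets.sets_into_space[OF A] by (auto simp: space_sum_space split: if_splits)
    also have "\<dots> \<in> sets (sum_space S T)" using A unfolding sets_sum_space by auto
    finally show "?g -` A \<inter> space (sum_space S T) \<in> sets (sum_space S T)" .
  qed
  have "?L = space S <+> {}" by auto
  then have L: "?L \<in> sets (sum_space S T)"
    unfolding sets_sum_space by blast
  have m: "(\<lambda>p. (?g (fst p), snd p)) \<in> sum_space S T \<Otimes>\<^sub>M N \<rightarrow>\<^sub>M S \<Otimes>\<^sub>M N"
    using g by (intro measurable_Pair measurable_compose[OF measurable_fst] measurable_snd)
  have "{(x, q). \<exists>s. x = Inl s \<and> (s, q) \<in> E} =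
      ((\<lambda>p. (?g (fst p), snd p)) -` E \<inter> space (sum_space S T \<Otimes>\<^sub>M N)) \<inter> (?L \<times> space N)"
    using sets.sets_into_space[OF assms] by (auto simp: space_pair_measure space_sum_space)
  also have "\<dots> \<in> sets (sum_space S T \<Otimes>\<^sub>M N)"
    by (intro sets.Int pair_measureI L sets.top measurable_sets[OF m assms])
  finally show ?thesis .
qed

lemma image_Inr_times_measurable:
  fixes S :: "'b measure" and T :: "'a measure"
  assumes "E \<in> sets (T \<Otimes>\<^sub>M N)"
  shows "{(x, q). \<exists>t. x = Inr t \<and> (t, q) \<in> E} \<in> sets (sum_space S T \<Otimes>\<^sub>M N)"
proof -
  let ?sw = "\<lambda>x. case x of Inl a \<Rightarrow> Inr a | Inr b \<Rightarrow> Inl b"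
  have sw: "?sw \<in> sum_space S T \<rightarrow>\<^sub>M sum_space T S"
  proof (rule measurableI)
    show "?sw x \<in> space (sum_space T S)" if "x \<in> space (sum_space S T)" for x
      using that by (auto simp: space_sum_space)
    fix C assume "C \<in> sets (sum_space T S)"
    then obtain A B where C: "C = A <+> B" "A \<in> sets T" "B \<in> sets S"
      unfolding sets_sum_space by blast
    then have "A \<subseteq> space T" "B \<subseteq> space S" by (auto dest: sets.sets_into_space)
    then have "?sw -` C \<inter> space (sum_space S T) = B <+> A"
      unfolding C space_sum_space by auto
    then show "?sw -` C \<inter> space (sum_space S T) \<in> sets (sum_space S T)"
      using C unfolding sets_sum_space by blast
  qed
  have m: "(\<lambda>p. (?sw (fst p), snd p)) \<in> sum_space S T \<Otimes>\<^sub>M N \<rightarrow>\<^sub>M sum_space T S \<Otimes>\<^sub>M N"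
    using sw by (intro measurable_Pair measurable_compose[OF measurable_fst] measurable_snd)
  have "{(x, q). \<exists>t. x = Inr t \<and> (t, q) \<in> E} =
      (\<lambda>p. (?sw (fst p), snd p)) -` {(x, q). \<exists>t. x = Inl t \<and> (t, q) \<in> E}
        \<inter> space (sum_space S T \<Otimes>\<^sub>M N)"
  proof (rule set_eqI, clarify)
    fix x :: "'b + 'a" and q
    have "E \<subseteq> space T \<times> space N"
      using sets.sets_into_space[OF assms] by (simp add: space_pair_measure)
    then show "(x, q) \<in> {(x, q). \<exists>t. x = Inr t \<and> (t, q) \<in> E} \<longleftrightarrow>
      (x, q) \<in> (\<lambda>p. (?sw (fst p), snd p)) -` {(x, q). \<exists>t. x = Inl t \<and> (t, q) \<in> E}
        \<inter> space (sum_space S T \<Otimes>\<^sub>M N)"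
      by (cases x) (auto simp: space_pair_measure space_sum_space)
  qed
  also have "\<dots> \<in> sets (sum_space S T \<Otimes>\<^sub>M N)"
    by (rule measurable_sets[OF m image_Inl_times_measurable[OF assms]])
  finally show ?thesis .
qed

lemma upper_closure_image_iff:
  assumes "h \<in> M \<rightarrow>\<^sub>M N" "A \<in> sets N" "F \<subseteq> sets M"
    and "\<And>A B. A \<in> F \<Longrightarrow> B \<in> sets M \<Longrightarrow> A \<subseteq> B \<Longrightarrow> B \<in> F"
  shows "(\<exists>D\<in>F. h ` D \<subseteq> A) \<longleftrightarrow> h -` A \<inter> space M \<in> F"
proof
  assume "\<exists>D\<in>F. h ` D \<subseteq> A"
  then obtain D where D: "D \<in> F" "h ` D \<subseteq> A" by blast
  then have "D \<subseteq> h -` A \<inter> space M" using assms(3) sets.sets_into_space by blast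
  with D assms(4) measurable_sets[OF assms(1,2)] show "h -` A \<inter> space M \<in> F" by blast
next
  assume "h -` A \<inter> space M \<in> F"
  then show "\<exists>D\<in>F. h ` D \<subseteq> A" by (rule bexI[rotated]) auto
qed

lemma direct_sum_Inl_iff:
  assumes "stochastic_effectivity S P" "s \<in> space S"
  shows "A \<in> direct_sum S P T Q (Inl s) \<longleftrightarrow>
    A \<in> sets (subprob_algebra (sum_space S T)) \<and>
    (\<lambda>\<mu>. distr \<mu> (sum_space S T) Inl) -` A \<inter> space (subprob_algebra S) \<in> P s"
proof -
  have F: "P s \<subseteq> sets (subprob_algebra S)"
    "\<And>A B. A \<in> P s \<Longrightarrow> B \<in> sets (subprob_algebra S) \<Longrightarrow> A \<subseteq> B \<Longrightarrow> B \<in> P s"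
    using assms unfolding stochastic_effectivity_def by blast+
  show ?thesis
    unfolding direct_sum_def mem_Collect_eq sum.case
    by (rule conj_cong[OF refl upper_closure_image_iff[OF
          measurable_distr[OF measurable_Inl_sum_space] _ F]])
qed

lemma direct_sum_Inr_iff:
  assumes "stochastic_effectivity T Q" "t \<in> space T"
  shows "A \<in> direct_sum S P T Q (Inr t) \<longleftrightarrow>
    A \<in> sets (subprob_algebra (sum_space S T)) \<and>
    (\<lambda>\<mu>. distr \<mu> (sum_space S T) Inr) -` A \<inter> space (subprob_algebra T) \<in> Q t"
proof -
  have F: "Q t \<subseteq> sets (subprob_algebra T)"
    "\<And>A B. A \<in> Q t \<Longrightarrow> B \<in> sets (subprob_algebra T) \<Longrightarrow> A \<subseteq> B \<Longrightarrow> B \<in> Q t"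
    using assms unfolding stochastic_effectivity_def by blast+
  show ?thesis
    unfolding direct_sum_def mem_Collect_eq sum.case
    by (rule conj_cong[OF refl upper_closure_image_iff[OF
          measurable_distr[OF measurable_Inr_sum_space] _ F]])
qed

lemma t_measurable_pullback:
  assumes "t_measurable S P" and i: "h \<in> subprob_algebra S \<rightarrow>\<^sub>M N"
    and H: "H \<in> sets (N \<Otimes>\<^sub>M unit_interval)"
  shows "{(s, q). s \<in> space S \<and> q \<in> {0..1} \<and>
      h -` {\<mu>. (\<mu>, q) \<in> H} \<inter> space (subprob_algebra S) \<in> P s} \<in> sets (S \<Otimes>\<^sub>M unit_interval)"
proof -
  let ?k = "\<lambda>p. (h (fst p), snd p)"
  let ?K = "?k -` H \<inter> space (subprob_algebra S \<Otimes>\<^sub>M unit_interval)"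
  have "?k \<in> subprob_algebra S \<Otimes>\<^sub>M unit_interval \<rightarrow>\<^sub>M N \<Otimes>\<^sub>M unit_interval"
    using i by (intro measurable_Pair measurable_compose[OF measurable_fst] measurable_snd)
  from measurable_sets[OF this H]
  have "{(s, q). s \<in> space S \<and> q \<in> {0..1} \<and> {\<mu>. (\<mu>, q) \<in> ?K} \<in> P s}
      \<in> sets (S \<Otimes>\<^sub>M unit_interval)"
    using assms(1) unfolding t_measurable_def by blast
  moreover have "{\<mu>. (\<mu>, q) \<in> ?K} = h -` {\<mu>. (\<mu>, q) \<in> H} \<inter> space (subprob_algebra S)"
    if "q \<in> {0..1}" for q
    using that by (auto simp: space_pair_measure space_restrict_space)
  then have "{(s, q). s \<in> space S \<and> q \<in> {0..1} \<and> {\<mu>. (\<mu>, q) \<in> ?K} \<in> P s} =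
    {(s, q). s \<in> space S \<and> q \<in> {0..1} \<and>
      h -` {\<mu>. (\<mu>, q) \<in> H} \<inter> space (subprob_algebra S) \<in> P s}"
    by (intro set_eqI) (clarsimp cong: conj_cong)
  ultimately show ?thesis by simp
qed

lemma stochastic_effectivity_direct_sum:
  fixes S :: "'a measure" and T :: "'b measure"
  assumes P: "stochastic_effectivity S P" and Q: "stochastic_effectivity T Q"
  shows "stochastic_effectivity (sum_space S T) (direct_sum S P T Q)"
proof -
  let ?N = "subprob_algebra (sum_space S T)"
  have "t_measurable (sum_space S T) (direct_sum S P T Q)"
    unfolding t_measurable_def
  proof
    fix H assume H: "H \<in> sets (?N \<Otimes>\<^sub>M unit_interval)"
    have Hq: "{\<mu>. (\<mu>, q) \<in> H} \<in> sets ?N" for q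
      using sets_Pair2[OF H, of q] by (simp add: vimage_def)
    let ?E = "{(s, q). s \<in> space S \<and> q \<in> {0..1} \<and>
      (\<lambda>\<mu>. distr \<mu> (sum_space S T) Inl) -` {\<mu>. (\<mu>, q) \<in> H} \<inter> space (subprob_algebra S) \<in> P s}"
    let ?F = "{(t, q). t \<in> space T \<and> q \<in> {0..1} \<and>
      (\<lambda>\<mu>. distr \<mu> (sum_space S T) Inr) -` {\<mu>. (\<mu>, q) \<in> H} \<inter> space (subprob_algebra T) \<in> Q t}"
    have PQ: "t_measurable S P" "t_measurable T Q"
      using P Q unfolding stochastic_effectivity_def by auto
    have E: "?E \<in> sets (S \<Otimes>\<^sub>M unit_interval)"
      by (rule t_measurable_pullback[OF PQ(1) measurable_distr[OF measurable_Inl_sum_space] H])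
    have F: "?F \<in> sets (T \<Otimes>\<^sub>M unit_interval)"
      by (rule t_measurable_pullback[OF PQ(2) measurable_distr[OF measurable_Inr_sum_space] H])
    have "{(x, q). x \<in> space (sum_space S T) \<and> q \<in> {0..1} \<and>
        {\<mu>. (\<mu>, q) \<in> H} \<in> direct_sum S P T Q x} =
      {(x, q). \<exists>s. x = Inl s \<and> (s, q) \<in> ?E} \<union> {(x, q). \<exists>t. x = Inr t \<and> (t, q) \<in> ?F}"
    proof (rule set_eqI, clarify)
      fix x :: "'a + 'b" and q
      show "(x, q) \<in> {(x, q). x \<in> space (sum_space S T) \<and> q \<in> {0..1} \<and>
          {\<mu>. (\<mu>, q) \<in> H} \<in> direct_sum S P T Q x} \<longleftrightarrow>
        (x, q) \<in> {(x, q). \<exists>s. x = Inl s \<and> (s, q) \<in> ?E} \<union> {(x, q). \<exists>t. x = Inr t \<and> (t, q) \<in> ?F}"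
      proof (cases x)
        case (Inl s)
        then have "x \<in> space (sum_space S T) \<longleftrightarrow> s \<in> space S"
          by (auto simp: space_sum_space)
        with Inl direct_sum_Inl_iff[OF P, of s "{\<mu>. (\<mu>, q) \<in> H}" T Q] Hq[of q]
        show ?thesis by blast
      next
        case (Inr t)
        then have "x \<in> space (sum_space S T) \<longleftrightarrow> t \<in> space T"
          by (auto simp: space_sum_space)
        with Inr direct_sum_Inr_iff[OF Q, of t "{\<mu>. (\<mu>, q) \<in> H}" S P] Hq[of q]
        show ?thesis by blast
      qed
    qed
    also have "\<dots> \<in> sets (sum_space S T \<Otimes>\<^sub>M unit_interval)"
      by (rule sets.Un[OF image_Inl_times_measurable[OF E] image_Inr_times_measurable[OF F]])
    finally show "{(x, q). x \<in> space (sum_space S T) \<and> q \<in> {0..1} \<and>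
        {\<mu>. (\<mu>, q) \<in> H} \<in> direct_sum S P T Q x} \<in> sets (sum_space S T \<Otimes>\<^sub>M unit_interval)" .
  qed
  moreover have "B \<in> direct_sum S P T Q x"
    if "A \<in> direct_sum S P T Q x" "B \<in> sets ?N" "A \<subseteq> B" for x A B
    using that by (cases x) (auto simp: direct_sum_def dest: subset_trans)
  moreover have "direct_sum S P T Q x \<subseteq> sets ?N" for x by (auto simp: direct_sum_def)
  ultimately show ?thesis unfolding stochastic_effectivity_def by blast
qed

end

theory Submission
  imports Defs
begin

text \<open>
  Extend \<open>f\<close> by the identity on \<open>T\<close> to a map \<open>h\<close> on the sum. The \<open>R\<close>-closed measurable sets are the
  preimages under \<open>h\<close> of measurable subsets of \<open>T\<close>, so two measures are related as soon as their
  images under \<open>h\<close> agree, and the required member of the effectivity function at the related point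
  is a preimage under \<open>\<nu> \<mapsto> distr \<nu> T h\<close>. From \<open>f s\<close> to \<open>s\<close> this is immediate; from \<open>s\<close> to \<open>f s\<close>
  every subprobability \<open>\<tau>\<close> on \<open>T\<close> must be the image under \<open>f\<close> of one on \<open>S\<close>.

  For this, \<open>f\<close> gets a measurable section defined \<open>\<tau>\<close>-almost everywhere. \<open>S\<close> has a countable,
  complete (in the sense of Frolik) family of countable covers whose members are each contained in
  or disjoint from prescribed Borel sets. Intersecting members of the first \<open>k\<close> covers gives a tree
  of sets \<open>A w\<close>. Up to null sets, the measurable envelope of \<open>f ` A w\<close> is covered by those of its
  children, so almost every \<open>t\<close> determines a branch measurably; completeness yields a point \<open>s\<close> on the
  branch, and \<open>f s = t\<close> because the covers decide the preimages of a countable family separating the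
  points of \<open>T\<close>. Envelopes make the measurability of analytic sets unnecessary.
\<close>

section \<open>Complete families of countable covers\<close>

text \<open>Each \<open>U \<in> \<U>\<close> is a cover of \<open>X\<close> by the sets \<open>U 0, U 1, \<dots>\<close>; a branch \<open>x\<close> picks one set from each.\<close>

definition complete_covers :: "'a set \<Rightarrow> (nat \<Rightarrow> 'a set) set \<Rightarrow> bool" where
  "complete_covers X \<U> \<longleftrightarrow> countable \<U> \<and> (\<forall>U\<in>\<U>. X \<subseteq> (\<Union>n. U n)) \<and>
     (\<forall>x. (\<forall>\<F>. finite \<F> \<longrightarrow> \<F> \<subseteq> \<U> \<longrightarrow> X \<inter> (\<Inter>U\<in>\<F>. U (x U)) \<noteq> {}) \<longrightarrow>
        (\<exists>s\<in>X. \<forall>U\<in>\<U>. s \<in> U (x U)))"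

text \<open>Which member of the cover contains a point of \<open>X\<close> then settles whether the
  point lies in \<open>B\<close>, so membership in \<open>B\<close> can be read off a
  branch.\<close>

definition decides :: "'a set \<Rightarrow> (nat \<Rightarrow> 'a set) \<Rightarrow> 'a set \<Rightarrow> bool" where
  "decides X U B \<longleftrightarrow> (\<forall>n. X \<inter> U n \<subseteq> B \<or> U n \<inter> B = {})"

definition separating_covers :: "'a set \<Rightarrow> (nat \<Rightarrow> 'a set) set \<Rightarrow> bool" where
  "separating_covers X \<V> \<longleftrightarrow>
     (\<forall>x. \<forall>s\<in>X. \<forall>s'\<in>X. (\<forall>V\<in>\<V>. s \<in> V (x V) \<and> s' \<in> V (x V)) \<longrightarrow> s = s')"

section \<open>Dense sequences and ball bases in separable metric spaces\<close>

lemma (in Metric_space) dense_sequence: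
  assumes "separable_space mtopology"
  obtains a :: "nat \<Rightarrow> 'a" where "\<And>x e. x \<in> M \<Longrightarrow> e > 0 \<Longrightarrow> \<exists>i. x \<in> mball (a i) e"
proof -
  obtain C where C: "countable C" "C \<subseteq> M" "mtopology closure_of C = M"
    using assms unfolding separable_space_def by auto
  \<comment> \<open>If \<open>C\<close> is empty, the sequence is arbitrary, but then
    \<open>M\<close> is empty as well and there is nothing to approximate.\<close>
  show ?thesis
  proof (rule that[of "from_nat_into C"])
    fix x and e :: real assume "x \<in> M" "e > 0"
    then have "x \<in> mtopology closure_of C" using C by simp
    then obtain c where c: "c \<in> C" "c \<in> mball x e"
      using \<open>e > 0\<close> unfolding metric_closure_of by blast
    obtain i where "from_nat_into C i = c"
      using c C(1) from_nat_into_surj by metis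
    then show "\<exists>i. x \<in> mball (from_nat_into C i) e"
      using c commute by (metis in_mball)
  qed
qed

text \<open>A radius below half of what \<open>U\<close> allows around \<open>x\<close> keeps even
  the closed ball about a nearby centre inside \<open>U\<close>. Closed balls are wanted because the
  covers below must have closed members.\<close>

lemma (in Metric_space) dense_sequence_ball_base:
  assumes a: "\<And>x e. x \<in> M \<Longrightarrow> e > 0 \<Longrightarrow> \<exists>i::nat. x \<in> mball (a i) e"
    and U: "openin mtopology U" "x \<in> U"
  shows "\<exists>i k. x \<in> mball (a i) (inverse (Suc k)) \<and> mcball (a i) (inverse (Suc k)) \<subseteq> U"
proof -
  have x: "x \<in> M" using U openin_subset by fastforce
  obtain r where r: "r > 0" "mball x r \<subseteq> U"
    using U unfolding openin_mtopology by blast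
  obtain k where k: "inverse (Suc k) < r / 2"
    using reals_Archimedean[of "r / 2"] r by auto
  obtain i where i: "x \<in> mball (a i) (inverse (Suc k))"
    using a[OF x, of "inverse (Suc k)"] by auto
  have "mcball (a i) (inverse (Suc k)) \<subseteq> mball x r"
    by (rule mcball_subset_mball) (use i k in auto)
  then show ?thesis using r i by blast
qed

lemma metrizable_separable_imp_second_countable:
  assumes "metrizable_space X" "separable_space X"
  shows "second_countable X"
proof -
  obtain M d where M: "Metric_space M d" "X = Metric_space.mtopology M d"
    using assms unfolding metrizable_space_def by blast
  interpret Metric_space M d by fact
  obtain a where a: "\<And>x e. x \<in> M \<Longrightarrow> e > 0 \<Longrightarrow> \<exists>i::nat. x \<in> mball (a i) e"
    using dense_sequence assms(2) M(2) by blast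
  let ?\<B> = "range (\<lambda>(i, k). mball (a i) (inverse (Suc k)))"
  have "\<exists>V\<in>?\<B>. x \<in> V \<and> V \<subseteq> U" if "openin X U" "x \<in> U" for U x
    using dense_sequence_ball_base[OF a, of U x] that M(2) mball_subset_mcball by fastforce
  moreover have "\<forall>V\<in>?\<B>. openin X V" using M(2) by auto
  ultimately show ?thesis unfolding second_countable_def
    by (intro exI[of _ ?\<B>]) auto
qed

section \<open>Complete covers that decide given Borel sets\<close>

text \<open>Cantor's intersection theorem: in a complete space, closed sets with the finite
  intersection property, some of them in arbitrarily small balls, have a common point. Every branch
  contains such small sets, since all members of the cover belonging to \<open>e\<close> are
  small.\<close>

lemma (in Metric_space) complete_covers_closed:
  assumes "mcomplete" "countable \<U>"
    and "\<And>U. U \<in> \<U> \<Longrightarrow> M \<subseteq> (\<Union>n. U n)"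
    and "\<And>U n. U \<in> \<U> \<Longrightarrow> closedin mtopology (U n)"
    and "\<And>e. e > 0 \<Longrightarrow> \<exists>U\<in>\<U>. \<forall>n. \<exists>a. U n \<subseteq> mcball a e"
  shows "complete_covers M \<U>"
  unfolding complete_covers_def
proof (intro conjI allI ballI impI assms)
  fix x assume fip: "\<forall>\<F>. finite \<F> \<longrightarrow> \<F> \<subseteq> \<U> \<longrightarrow> M \<inter> (\<Inter>U\<in>\<F>. U (x U)) \<noteq> {}"
  let ?\<C> = "(\<lambda>U. U (x U)) ` \<U>"
  have "\<Inter>\<F> \<noteq> {}" if F: "finite \<F>" "\<F> \<subseteq> ?\<C>" for \<F>
  proof -
    obtain \<G> where "finite \<G>" "\<G> \<subseteq> \<U>" "\<F> = (\<lambda>U. U (x U)) ` \<G>"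
      using finite_subset_image[OF F] by metis
    then show ?thesis using fip by auto
  qed
  moreover have "\<exists>C a. C \<in> ?\<C> \<and> C \<subseteq> mcball a e" if e: "e > 0" for e
    using assms(5)[OF e] by blast
  moreover have "\<forall>C\<in>?\<C>. closedin mtopology C" using assms(4) by auto
  ultimately have "\<Inter>?\<C> \<noteq> {}"
    using assms(1)[unfolded mcomplete_fip, rule_format, of ?\<C>] by blast
  then obtain s where s: "s \<in> \<Inter>?\<C>" by blast
  moreover have "s \<in> M"
  proof -
    \<comment> \<open>The radius 1 only serves to find some cover in \<open>\<U>\<close>; its closed
      members lie in \<open>M\<close>.\<close>
    obtain U where "U \<in> \<U>" using assms(5)[of 1] by auto
    with s assms(4)[of U "x U"] show ?thesis using closedin_subset by fastforce
  qed
  ultimately show "\<exists>s\<in>M. \<forall>U\<in>\<U>. s \<in> U (x U)" by auto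
qed

text \<open>Without the common separating part \<open>\<V>\<close>, the points found for the individual families on one
  branch could differ.\<close>

lemma complete_covers_Union:
  assumes "countable I" "I \<noteq> {}"
    and "\<And>i. i \<in> I \<Longrightarrow> complete_covers X (\<U> i)" "\<And>i. i \<in> I \<Longrightarrow> \<V> \<subseteq> \<U> i"
    and "separating_covers X \<V>"
  shows "complete_covers X (\<Union>i\<in>I. \<U> i)"
  unfolding complete_covers_def
proof (intro conjI allI impI)
  show "countable (\<Union>i\<in>I. \<U> i)" "\<forall>U\<in>\<Union>i\<in>I. \<U> i. X \<subseteq> (\<Union>n. U n)"
    using assms(1,3) unfolding complete_covers_def by auto
  fix x
  assume fip: "\<forall>\<F>. finite \<F> \<longrightarrow> \<F> \<subseteq> (\<Union>i\<in>I. \<U> i) \<longrightarrow> X \<inter> (\<Inter>U\<in>\<F>. U (x U)) \<noteq> {}"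
  have "\<exists>s\<in>X. \<forall>U\<in>\<U> i. s \<in> U (x U)" if "i \<in> I" for i
  proof -
    have "\<forall>\<F>. finite \<F> \<longrightarrow> \<F> \<subseteq> \<U> i \<longrightarrow> X \<inter> (\<Inter>U\<in>\<F>. U (x U)) \<noteq> {}"
      using fip that by (metis UN_upper subset_trans)
    then show ?thesis using assms(3)[OF that] unfolding complete_covers_def by blast
  qed
  then obtain s where s: "\<And>i. i \<in> I \<Longrightarrow> s i \<in> X" "\<And>i U. i \<in> I \<Longrightarrow> U \<in> \<U> i \<Longrightarrow> s i \<in> U (x U)"
    by metis
  have eq: "s i = s j" if "i \<in> I" "j \<in> I" for i j
  proof -
    have "\<forall>V\<in>\<V>. s i \<in> V (x V) \<and> s j \<in> V (x V)"
      using s(2) assms(4) that by blast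
    then show ?thesis using assms(5) s(1) that unfolding separating_covers_def by blast
  qed
  obtain i where i: "i \<in> I" using assms(2) by blast
  have "s i \<in> U (x U)" if "j \<in> I" "U \<in> \<U> j" for j U
    using s(2)[OF that] eq[OF i that(1)] by simp
  then show "\<exists>s\<in>X. \<forall>U\<in>\<Union>i\<in>I. \<U> i. s \<in> U (x U)"
    using s(1)[OF i] by blast
qed

text \<open>\<open>W\<close> consists of the complement of the union and of the sets
  \<open>B i\<close>. The point found on a branch of \<open>\<U>\<close> already lies in the chosen
  member of \<open>W\<close>: that member meets the chosen member of each cover deciding
  \<open>B i\<close>, which forces the point to the matching side of \<open>B i\<close>.\<close>

lemma decides_countable_Union:
  assumes "complete_covers X \<U>" "\<And>i::nat. \<exists>U\<in>\<U>. decides X U (B i)" "(\<Union>i. B i) \<subseteq> X"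
  shows "\<exists>W. complete_covers X (insert W \<U>) \<and> decides X W (\<Union>i. B i)"
proof (intro exI conjI)
  let ?W = "\<lambda>n. case n of 0 \<Rightarrow> X - (\<Union>i. B i) | Suc i \<Rightarrow> B i"
  show "decides X ?W (\<Union>i. B i)" unfolding decides_def by (auto split: nat.split)
  show "complete_covers X (insert ?W \<U>)"
    unfolding complete_covers_def
  proof (intro conjI allI impI)
    have "s \<in> (\<Union>n. ?W n)" if "s \<in> X" for s
    proof (cases "s \<in> (\<Union>i. B i)")
      case True
      then obtain i where "s \<in> ?W (Suc i)" by auto
      then show ?thesis by blast
    next
      case False
      then have "s \<in> ?W 0" using that by simp
      then show ?thesis by blast
    qed
    then have "X \<subseteq> (\<Union>n. ?W n)" by blast
    then show "countable (insert ?W \<U>)" "\<forall>U\<in>insert ?W \<U>. X \<subseteq> (\<Union>n. U n)"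
      using assms(1) unfolding complete_covers_def by auto
    fix x
    assume fip: "\<forall>\<F>. finite \<F> \<longrightarrow> \<F> \<subseteq> insert ?W \<U> \<longrightarrow> X \<inter> (\<Inter>U\<in>\<F>. U (x U)) \<noteq> {}"
    have "\<forall>\<F>. finite \<F> \<longrightarrow> \<F> \<subseteq> \<U> \<longrightarrow> X \<inter> (\<Inter>U\<in>\<F>. U (x U)) \<noteq> {}"
    proof (intro allI impI)
      fix \<F> assume "finite \<F>" "\<F> \<subseteq> \<U>"
      then show "X \<inter> (\<Inter>U\<in>\<F>. U (x U)) \<noteq> {}" using fip[rule_format, of \<F>] by auto
    qed
    then have "\<exists>s\<in>X. \<forall>U\<in>\<U>. s \<in> U (x U)"
      using assms(1)[unfolded complete_covers_def, THEN conjunct2, THEN conjunct2, rule_format, of x]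
      by simp
    then obtain s where s: "s \<in> X" "\<And>U. U \<in> \<U> \<Longrightarrow> s \<in> U (x U)" by blast
    have pair: "X \<inter> ?W (x ?W) \<inter> U (x U) \<noteq> {}" if "U \<in> \<U>" for U
      using fip[rule_format, of "{?W, U}"] that by auto
    have "s \<in> ?W (x ?W)"
    proof (cases "x ?W")
      case 0
      have "s \<notin> B i" for i
      proof
        assume "s \<in> B i"
        obtain U where U: "U \<in> \<U>" "decides X U (B i)" using assms(2) by blast
        then have "X \<inter> U (x U) \<subseteq> B i" using s \<open>s \<in> B i\<close> unfolding decides_def by blast
        then show False using pair[OF U(1)] 0 by auto
      qed
      then show ?thesis using 0 s by auto
    next
      case (Suc i)
      obtain U where U: "U \<in> \<U>" "decides X U (B i)" using assms(2) by blast
      then have "X \<inter> U (x U) \<subseteq> B i" using pair[OF U(1)] Suc unfolding decides_def by auto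
      then show ?thesis using s U Suc by auto
    qed
    then show "\<exists>s\<in>X. \<forall>U\<in>insert ?W \<U>. s \<in> U (x U)" using s by auto
  qed
qed

text \<open>\<open>\<V>\<close> consists of covers by closed balls whose radii tend to 0, so two
  points sharing a member of each have distance 0. An open \<open>B\<close> is decided by a cover
  with closed members: its complement and the closed balls inside it.\<close>

lemma completely_metrizable_covers:
  assumes "completely_metrizable_space X" "separable_space X"
  obtains \<V> where "separating_covers (topspace X) \<V>"
    "\<And>B. openin X B \<Longrightarrow> \<exists>U. complete_covers (topspace X) (insert U \<V>) \<and> decides (topspace X) U B"
proof -
  obtain M d where M: "Metric_space M d" "Metric_space.mcomplete M d" "X = Metric_space.mtopology M d"
    using assms unfolding completely_metrizable_space_def by blast
  interpret Metric_space M d by fact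
  obtain a where a: "\<And>x e. x \<in> M \<Longrightarrow> e > 0 \<Longrightarrow> \<exists>i::nat. x \<in> mball (a i) e"
    using dense_sequence assms(2) M(3) by blast
  define V where "V k n = mcball (a n) (inverse (Suc k))" for k n
  have V_D: "a n \<in> M" "d (a n) s \<le> inverse (Suc k)" if "s \<in> V k n" for s k n
    using that unfolding V_def by auto
  have V_cover: "M \<subseteq> (\<Union>n. V k n)" for k
  proof
    fix s assume "s \<in> M"
    then obtain i where "s \<in> mball (a i) (inverse (Suc k))"
      using a[of s "inverse (Suc k)"] by auto
    then show "s \<in> (\<Union>n. V k n)" unfolding V_def using mball_subset_mcball by blast
  qed
  show ?thesis
  proof (rule that[of "range V"])
    show "separating_covers (topspace X) (range V)"
      unfolding separating_covers_def M(3) topspace_mtopology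
    proof (intro allI ballI impI)
      fix x s s' assume s: "s \<in> M" "s' \<in> M" "\<forall>V\<in>range V. s \<in> V (x V) \<and> s' \<in> V (x V)"
      have "d s s' \<le> 0"
      proof (rule field_le_epsilon)
        fix e :: real assume "e > 0"
        then obtain k where k: "inverse (Suc k) < e / 2"
          using reals_Archimedean[of "e / 2"] by auto
        have "s \<in> V k (x (V k))" "s' \<in> V k (x (V k))" using s by auto
        then have "a (x (V k)) \<in> M" "d (a (x (V k))) s \<le> inverse (Suc k)"
            "d (a (x (V k))) s' \<le> inverse (Suc k)"
          using V_D by blast+
        then have "d s s' \<le> 2 * inverse (Suc k)"
          using triangle''[of s "a (x (V k))" s'] s(1,2) by simp
        then show "d s s' \<le> 0 + e" using k by simp
      qed
      then show "s = s'" using s(1,2) zero nonneg[of s s'] by (simp add: order_antisym)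
    qed
    fix B assume "openin X B"
    then have B: "openin mtopology B" using M(3) by simp
    \<comment> \<open>Index 0 is the complement of \<open>B\<close>; \<open>Suc m\<close> codes a
      centre and a radius, with \<open>{}\<close> in place of the balls that leave
      \<open>B\<close>.\<close>
    define U where "U n = (case n of 0 \<Rightarrow> M - B | Suc m \<Rightarrow> (case prod_decode m of (i, k) \<Rightarrow>
        if mcball (a i) (inverse (Suc k)) \<subseteq> B then mcball (a i) (inverse (Suc k)) else {}))" for n
    have "decides M U B"
      unfolding decides_def U_def by (auto split: nat.split prod.split)
    moreover have "complete_covers M (insert U (range V))"
    proof (rule complete_covers_closed[OF M(2)])
      show "closedin mtopology (W n)" if "W \<in> insert U (range V)" for W n
        using that B unfolding U_def V_def by (auto split: nat.split prod.split)
      have "s \<in> (\<Union>n. U n)" if "s \<in> M" for s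
      proof (cases "s \<in> B")
        case True
        then obtain i k where "s \<in> mball (a i) (inverse (Suc k))" "mcball (a i) (inverse (Suc k)) \<subseteq> B"
          using dense_sequence_ball_base[OF a B] by blast
        then have "s \<in> U (Suc (prod_encode (i, k)))"
          unfolding U_def using mball_subset_mcball by auto
        then show ?thesis by blast
      next
        case False
        then have "s \<in> U 0" using that unfolding U_def by simp
        then show ?thesis by blast
      qed
      then show "M \<subseteq> (\<Union>n. W n)" if "W \<in> insert U (range V)" for W
        using that V_cover by auto
      fix e :: real assume "e > 0"
      then obtain k where "inverse (Suc k) < e" using reals_Archimedean by auto
      then have "V k n \<subseteq> mcball (a n) e" for n
        unfolding V_def by (intro mcball_subset_concentric) auto
      then show "\<exists>U\<in>insert U (range V). \<forall>n. \<exists>a. U n \<subseteq> mcball a e" by blast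
    qed simp
    ultimately show "\<exists>U. complete_covers (topspace X) (insert U (range V)) \<and> decides (topspace X) U B"
      unfolding M(3) topspace_mtopology by blast
  qed
qed

text \<open>This plays the role of refining a Polish topology until given Borel sets become clopen.
  The induction keeps the same \<open>\<V>\<close> inside every family, so that countably many
  families can be united. A complement is decided by the cover deciding the set, and a countable
  union by one added cover.\<close>

lemma borel_complete_covers:
  assumes "completely_metrizable_space X" "separable_space X"
    and "countable \<B>" "\<B> \<subseteq> sigma_sets (topspace X) {U. openin X U}"
  obtains \<U> where "complete_covers (topspace X) \<U>" "\<And>B. B \<in> \<B> \<Longrightarrow> \<exists>U\<in>\<U>. decides (topspace X) U B"
proof -
  obtain \<V> where V: "separating_covers (topspace X) \<V>"
    "\<And>B. openin X B \<Longrightarrow> \<exists>U. complete_covers (topspace X) (insert U \<V>) \<and> decides (topspace X) U B"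
    using completely_metrizable_covers assms(1,2) by metis
  have one: "\<exists>\<U>. \<V> \<subseteq> \<U> \<and> complete_covers (topspace X) \<U> \<and> (\<exists>U\<in>\<U>. decides (topspace X) U B)"
    if "B \<in> sigma_sets (topspace X) {U. openin X U}" for B
    using that
  proof induction
    case (Basic B)
    then show ?case using V(2)[of B] by blast
  next
    case Empty
    show ?case using V(2)[of "{}"] by auto
  next
    case (Compl B)
    then obtain \<U> U where U: "\<V> \<subseteq> \<U>" "complete_covers (topspace X) \<U>" "U \<in> \<U>" "decides (topspace X) U B"
      by blast
    then have "decides (topspace X) U (topspace X - B)" unfolding decides_def by blast
    then show ?case using U by blast
  next
    case (Union B)
    then obtain \<U> where U: "\<And>i. \<V> \<subseteq> \<U> i" "\<And>i. complete_covers (topspace X) (\<U> i)"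
        "\<And>i. \<exists>U\<in>\<U> i. decides (topspace X) U (B i)"
      by metis
    have "complete_covers (topspace X) (\<Union>i. \<U> i)"
      by (rule complete_covers_Union[where \<V> = \<V>]) (use U V in auto)
    moreover have "(\<Union>i. B i) \<subseteq> topspace X"
      using sigma_sets_into_sp[of "{U. openin X U}" "topspace X"] Union(1) openin_subset by blast
    ultimately obtain W where "complete_covers (topspace X) (insert W (\<Union>i. \<U> i))"
        "decides (topspace X) W (\<Union>i. B i)"
      using decides_countable_Union[of "topspace X" "\<Union>i. \<U> i" B] U(3) by (metis UN_I UNIV_I)
    then show ?case using U(1) by (intro exI[of _ "insert W (\<Union>i. \<U> i)"]) auto
  qed
  then obtain \<U> where U: "\<And>B. B \<in> \<B> \<Longrightarrow> \<V> \<subseteq> \<U> B" "\<And>B. B \<in> \<B> \<Longrightarrow> complete_covers (topspace X) (\<U> B)"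
      "\<And>B. B \<in> \<B> \<Longrightarrow> \<exists>U\<in>\<U> B. decides (topspace X) U B"
    using assms(4) by (metis subsetD)
  show ?thesis
  proof (cases "\<B> = {}")
    case True
    then show ?thesis using that V(2)[of "{}"] by auto
  next
    case False
    have "complete_covers (topspace X) (\<Union>B\<in>\<B>. \<U> B)"
      by (rule complete_covers_Union[where \<V> = \<V>]) (use U V assms False in auto)
    then show ?thesis using that U(3) by (metis UN_I)
  qed
qed

section \<open>Measurable sections almost everywhere\<close>

text \<open>\<open>E - K\<close> is a measurable part of the envelope that misses \<open>A\<close>,
  and such parts are null.\<close>

lemma envelope_minimal:
  assumes "measurable_envelope M A E" "K \<in> sets M" "A \<subseteq> K"
  shows "E - K \<in> null_sets M"
  using measurable_envelopeD1[OF assms(1), of "E - K"] measurable_envelopeD[OF assms(1)] assms(2,3)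
  by auto

text \<open>Deciding the generator \<open>\<G>\<close> makes \<open>g\<close> measurable; deciding
  the preimages of the separating family \<open>\<O>\<close> makes it a section.\<close>

lemma AE_measurable_section:
  fixes f :: "'a \<Rightarrow> 'b" and S :: "'a measure" and \<tau> :: "'b measure"
  assumes "finite_measure \<tau>" "space S \<noteq> {}" "f ` space S = space \<tau>"
    and covers: "complete_covers (space S) \<U>" "\<U> \<noteq> {}"
    and generator: "sets S = sigma_sets (space S) \<G>" "\<G> \<subseteq> Pow (space S)"
      "\<And>B. B \<in> \<G> \<Longrightarrow> \<exists>U\<in>\<U>. decides (space S) U B"
    and separating: "countable \<O>" "\<O> \<subseteq> sets \<tau>"
      "\<And>t t'. t \<in> space \<tau> \<Longrightarrow> t' \<in> space \<tau> \<Longrightarrow> t \<noteq> t' \<Longrightarrow> \<exists>B\<in>\<O>. t \<in> B \<and> t' \<notin> B"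
      "\<And>B. B \<in> \<O> \<Longrightarrow> \<exists>U\<in>\<U>. decides (space S) U (f -` B \<inter> space S)"
  obtains g where "g \<in> \<tau> \<rightarrow>\<^sub>M S" "AE t in \<tau>. f (g t) = t"
proof -
  interpret finite_measure \<tau> by fact
  let ?X = "space S"
  have U: "countable \<U>" "\<And>U. U \<in> \<U> \<Longrightarrow> ?X \<subseteq> (\<Union>n. U n)"
    using covers(1) unfolding complete_covers_def by auto
  \<comment> \<open>A finite \<open>\<U>\<close> is enumerated with repetitions; every cover
    \<open>U\<close> still occurs at index \<open>?i U\<close>.\<close>
  define u where "u = from_nat_into \<U>"
  have u: "u j \<in> \<U>" for j unfolding u_def by (rule from_nat_into[OF covers(2)])
  let ?i = "to_nat_on \<U>"
  have ui: "u (?i U) = U" if "U \<in> \<U>" for U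
    unfolding u_def using that U(1) by simp
  \<comment> \<open>Tree nodes are lists with the latest choice at the head.\<close>
  define A where "A = rec_list ?X (\<lambda>n w Aw. Aw \<inter> u (length w) n)"
  have A: "A [] = ?X" "A (n # w) = A w \<inter> u (length w) n" for n w
    unfolding A_def by auto
  have A_sub: "A w \<subseteq> ?X" for w by (induction w) (auto simp: A)
  have A_split: "A w \<subseteq> (\<Union>n. A (n # w))" for w
  proof
    fix s assume s: "s \<in> A w"
    then obtain n where "s \<in> u (length w) n" using A_sub[of w] U(2)[OF u[of "length w"]] by blast
    then have "s \<in> A (n # w)" using s by (simp add: A)
    then show "s \<in> (\<Union>n. A (n # w))" by blast
  qed
  have "\<exists>H. measurable_envelope \<tau> (f ` A w) H" for w
  proof -
    have sub: "f ` A w \<subseteq> space \<tau>" using A_sub[of w] assms(3) by blast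
    obtain H where H: "H \<in> sets \<tau>" "f ` A w \<subseteq> H" "outer_measure_of \<tau> (f ` A w) = emeasure \<tau> H"
      using outer_measure_of_attain[OF sub] by blast
    \<comment> \<open>A measurable superset with the same outer measure is an envelope because
      \<open>\<tau>\<close> is finite.\<close>
    then have "measurable_envelope \<tau> (f ` A w) H"
      by (subst measurable_envelope_eq2) (auto simp: less_top[symmetric])
    then show ?thesis ..
  qed
  then obtain H where H: "\<And>w. measurable_envelope \<tau> (f ` A w) (H w)" by metis
  have H_sets [measurable]: "H w \<in> sets \<tau>" and H_sub: "f ` A w \<subseteq> H w" for w
    using measurable_envelopeD[OF H[of w]] by auto
  \<comment> \<open>\<open>{}\<close> will keep the sets \<open>A w\<close> nonempty along the
    branch of a point off the null set; the members of \<open>\<O>\<close> will identify the image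
    of \<open>g t\<close>.\<close>
  define \<K> where "\<K> = insert {} (\<O> \<union> (\<lambda>B. space \<tau> - B) ` \<O>)"
  have K: "countable \<K>" "\<K> \<subseteq> sets \<tau>" unfolding \<K>_def using separating(1,2) by auto
  \<comment> \<open>Off \<open>N\<close>, a point of \<open>H w\<close> lies in the envelope of some
    child and in every member of \<open>\<K>\<close> that contains the image of
    \<open>A w\<close>.\<close>
  define N where "N = (\<Union>w. H w - (\<Union>n. H (n # w))) \<union>
    (\<Union>w. \<Union>K\<in>{K\<in>\<K>. f ` A w \<subseteq> K}. H w - K)"
  have N: "N \<in> null_sets \<tau>"
    unfolding N_def
  proof (intro null_sets.Un null_sets_UN null_sets_UN')
    show "countable {K \<in> \<K>. f ` A w \<subseteq> K}" for w using K(1) by simp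
    show "H w - (\<Union>n. H (n # w)) \<in> null_sets \<tau>" for w
    proof (rule envelope_minimal[OF H])
      show "f ` A w \<subseteq> (\<Union>n. H (n # w))" using A_split[of w] H_sub by blast
    qed auto
    show "H w - B \<in> null_sets \<tau>" if "B \<in> {K\<in>\<K>. f ` A w \<subseteq> K}" for w B
      by (rule envelope_minimal[OF H]) (use that K(2) in auto)
  qed
  \<comment> \<open>Following the least child whose envelope contains \<open>t\<close> makes the
    branch a measurable function of \<open>t\<close>.\<close>
  define path where "path t = rec_nat [] (\<lambda>_ w. (LEAST n. t \<in> H (n # w)) # w)" for t
  define x where "x t k = (LEAST n. t \<in> H (n # path t k))" for t k
  have path: "path t 0 = []" "path t (Suc k) = x t k # path t k" for t k
    unfolding path_def x_def by auto
  have len: "length (path t k) = k" for t k by (induction k) (auto simp: path)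
  have path_H: "t \<in> H (path t k)" if t: "t \<in> space \<tau> - N" for t k
  proof (induction k)
    case 0
    show ?case using H_sub[of "[]"] assms(3) t by (auto simp: path A)
  next
    case (Suc k)
    then have "\<exists>n. t \<in> H (n # path t k)" using t unfolding N_def by blast
    then show ?case unfolding path x_def by (rule LeastI_ex)
  qed
  have path_K: "t \<in> B" if "t \<in> space \<tau> - N" "B \<in> \<K>" "f ` A (path t k) \<subseteq> B" for t B k
    using path_H[OF that(1), of k] that unfolding N_def by blast
  have A_path: "j < k \<Longrightarrow> A (path t k) \<subseteq> u j (x t j)" for t j k
    by (induction k) (auto simp: path A len less_Suc_eq)
  have point: "\<exists>s\<in>?X. \<forall>U\<in>\<U>. s \<in> U (x t (?i U))" if t: "t \<in> space \<tau> - N" for t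
  proof -
    have "?X \<inter> (\<Inter>U\<in>\<F>. U (x t (?i U))) \<noteq> {}" if F: "finite \<F>" "\<F> \<subseteq> \<U>" for \<F>
    proof -
      have "finite (?i ` \<F>)" using F by simp
      then obtain k where k: "\<And>U. U \<in> \<F> \<Longrightarrow> ?i U < k"
        unfolding finite_nat_set_iff_bounded by blast
      have "A (path t k) \<noteq> {}" using path_K[OF t, of "{}" k] unfolding \<K>_def by auto
      then obtain s where s: "s \<in> A (path t k)" by blast
      have "s \<in> U (x t (?i U))" if "U \<in> \<F>" for U
        using A_path[OF k[OF that], of t] s ui[OF subsetD[OF F(2) that]] by auto
      then show ?thesis using s A_sub by blast
    qed
    then show ?thesis
      using covers(1)[unfolded complete_covers_def, THEN conjunct2, THEN conjunct2, rule_format,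
          of "\<lambda>U. x t (?i U)"] by simp
  qed
  obtain s0 where s0: "s0 \<in> ?X" using assms(2) by blast
  \<comment> \<open>The constant value \<open>s0\<close> on \<open>N\<close> keeps \<open>g\<close>
    inside \<open>S\<close> and changes preimages only by a measurable null set.\<close>
  define g where "g t = (if t \<in> space \<tau> - N
    then SOME s. s \<in> ?X \<and> (\<forall>U\<in>\<U>. s \<in> U (x t (?i U))) else s0)" for t
  have g: "g t \<in> ?X" "\<And>U. U \<in> \<U> \<Longrightarrow> g t \<in> U (x t (?i U))" if "t \<in> space \<tau> - N" for t
    using someI_ex[OF point[OF that, unfolded Bex_def]] that unfolding g_def by auto
  have g_space: "g t \<in> ?X" for t
    using g(1)[of t] s0 by (cases "t \<in> space \<tau> - N") (auto simp: g_def)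
  have fg: "f (g t) = t" if t: "t \<in> space \<tau> - N" for t
  proof (rule ccontr)
    assume "f (g t) \<noteq> t"
    moreover have "f (g t) \<in> space \<tau>" using g_space assms(3) by blast
    ultimately obtain B where B: "B \<in> \<O>" "f (g t) \<in> B" "t \<notin> B"
      using separating(3)[of "f (g t)" t] t by blast
    then obtain V where V: "V \<in> \<U>" "decides ?X V (f -` B \<inter> ?X)" using separating(4) by blast
    have "g t \<in> V (x t (?i V)) \<inter> (f -` B \<inter> ?X)" using g(2)[OF t V(1)] B g_space by auto
    then have "?X \<inter> V (x t (?i V)) \<subseteq> f -` B" using V(2) unfolding decides_def by blast
    \<comment> \<open>A path of length \<open>k\<close> records the choices with index below
      \<open>k\<close>, hence the \<open>Suc\<close>.\<close>
    moreover have "A (path t (Suc (?i V))) \<subseteq> V (x t (?i V))"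
      using A_path[of "?i V" "Suc (?i V)" t] ui[OF V(1)] by simp
    ultimately have "f ` A (path t (Suc (?i V))) \<subseteq> B" using A_sub by blast
    then show False using path_K[OF t, of B] B unfolding \<K>_def by blast
  qed
  have path_meas: "(\<lambda>t. path t k) \<in> \<tau> \<rightarrow>\<^sub>M count_space UNIV" for k
  proof (induction k)
    case (Suc k)
    \<comment> \<open>The next node is measurable in \<open>t\<close> for each fixed
      \<open>w\<close>; as there are only countably many nodes, the measurable previous path may be
      substituted for \<open>w\<close>.\<close>
    have "(\<lambda>t. (LEAST n. t \<in> H (n # w)) # w) \<in> \<tau> \<rightarrow>\<^sub>M count_space UNIV" for w
      by measurable
    from measurable_compose_countable[OF this Suc] show ?case by (simp add: path x_def)
  qed (simp add: path)
  have x_meas: "(\<lambda>t. x t k) \<in> \<tau> \<rightarrow>\<^sub>M count_space UNIV" for k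
    unfolding x_def
    by (rule measurable_compose_countable[OF _ path_meas]) measurable
  have "g \<in> \<tau> \<rightarrow>\<^sub>M S"
  proof (rule measurable_sigma_sets[OF generator(1,2)])
    show "g \<in> space \<tau> \<rightarrow> ?X" using g_space by auto
    fix B assume "B \<in> \<G>"
    then obtain V where V: "V \<in> \<U>" "decides ?X V B" using generator(3) by blast
    \<comment> \<open>Membership of \<open>g t\<close> in \<open>B\<close> depends on one index of
      the branch alone, so the arbitrary choice of a point on the branch cannot spoil
      measurability.\<close>
    have good: "g t \<in> B \<longleftrightarrow> ?X \<inter> V (x t (?i V)) \<subseteq> B" if "t \<in> space \<tau> - N" for t
      using g[OF that] V unfolding decides_def by blast
    have "g -` B \<inter> space \<tau> = ({t\<in>space \<tau>. ?X \<inter> V (x t (?i V)) \<subseteq> B} - N) \<union> (if s0 \<in> B then N else {})"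
      using good null_setsD2[OF N] sets.sets_into_space[of N \<tau>]
      by (auto simp: g_def split: if_splits)
    also have "\<dots> \<in> sets \<tau>"
    proof -
      have "Measurable.pred \<tau> (\<lambda>t. ?X \<inter> V (x t (?i V)) \<subseteq> B)"
        by (rule measurable_compose[OF x_meas]) simp
      then show ?thesis using null_setsD2[OF N] by (auto simp: pred_def)
    qed
    finally show "g -` B \<inter> space \<tau> \<in> sets \<tau>" .
  qed
  moreover have "AE t in \<tau>. f (g t) = t"
    by (rule AE_I'[OF N]) (use fg in auto)
  ultimately show thesis using that by blast
qed

section \<open>Surjectivity of the image-measure map\<close>

text \<open>A countable base of the topology works: each open set is a countable union of basic
  sets, and metrizable spaces are T1. It supplies the generator on \<open>S\<close> and the
  separating family on \<open>T\<close>.\<close>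

lemma standard_borel_separating:
  assumes "standard_borel T"
  obtains \<O> where "countable \<O>" "\<O> \<subseteq> sets T" "sets T = sigma_sets (space T) \<O>"
    "\<And>t t'. t \<in> space T \<Longrightarrow> t' \<in> space T \<Longrightarrow> t \<noteq> t' \<Longrightarrow> \<exists>B\<in>\<O>. t \<in> B \<and> t' \<notin> B"
proof -
  obtain X where X: "completely_metrizable_space X" "separable_space X"
      "topspace X = space T" "sets T = sigma_sets (topspace X) {U. openin X U}"
    using assms unfolding standard_borel_def by blast
  obtain \<B> where B: "countable \<B>" "\<And>V. V \<in> \<B> \<Longrightarrow> openin X V"
      "\<And>U x. openin X U \<Longrightarrow> x \<in> U \<Longrightarrow> \<exists>V\<in>\<B>. x \<in> V \<and> V \<subseteq> U"
    using metrizable_separable_imp_second_countable[OF completely_metrizable_imp_metrizable_space[OF X(1)] X(2)]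
    unfolding second_countable_def by auto
  have B_sets: "\<B> \<subseteq> sets T" using X(4) B(2) by auto
  moreover have "sets T = sigma_sets (space T) \<B>"
  proof
    have "U \<in> sigma_sets (space T) \<B>" if "openin X U" for U
    proof -
      have "countable {V\<in>\<B>. V \<subseteq> U}" using B(1) by simp
      moreover have "U = \<Union>{V\<in>\<B>. V \<subseteq> U}" using B(3)[OF that] by blast
      moreover have "sigma_algebra (space T) (sigma_sets (space T) \<B>)"
        using B_sets sets.space_closed by (intro sigma_algebra_sigma_sets) blast
      ultimately show ?thesis
        using sigma_algebra.countable_Union[of "space T" "sigma_sets (space T) \<B>" "{V\<in>\<B>. V \<subseteq> U}"]
        by auto
    qed
    then show "sets T \<subseteq> sigma_sets (space T) \<B>"
      unfolding X(3,4) by (intro sigma_sets_mono) auto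
    show "sigma_sets (space T) \<B> \<subseteq> sets T" using B_sets by (rule sets.sigma_sets_subset)
  qed
  moreover have "\<exists>V\<in>\<B>. t \<in> V \<and> t' \<notin> V" if t: "t \<in> space T" "t' \<in> space T" "t \<noteq> t'" for t t'
  proof -
    have "t1_space X"
      using X(1) completely_metrizable_imp_metrizable_space metrizable_imp_t1_space by blast
    then obtain U where U: "openin X U" "t \<in> U" "t' \<notin> U"
      using t X(3) unfolding t1_space_def by metis
    then show ?thesis using B(3)[OF U(1,2)] by blast
  qed
  ultimately show thesis by (intro that[OF B(1)])
qed

text \<open>\<open>\<sigma>\<close> is the image of \<open>\<tau>\<close> under an almost sure
  section \<open>g\<close> of \<open>f\<close>; mapping it on by \<open>f\<close> returns
  \<open>\<tau>\<close>, as \<open>f \<circ> g\<close> is the identity almost everywhere.\<close>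

lemma subprob_distr_surjective:
  assumes "standard_borel S" "standard_borel T"
    and f: "f \<in> S \<rightarrow>\<^sub>M T" "f ` space S = space T"
    and tau: "\<tau> \<in> space (subprob_algebra T)"
  obtains \<sigma> where "\<sigma> \<in> space (subprob_algebra S)" "distr \<sigma> T f = \<tau>"
proof -
  have sets_tau: "sets \<tau> = sets T" and "subprob_space \<tau>"
    using tau by (auto simp: space_subprob_algebra)
  interpret subprob_space \<tau> by fact
  have space_tau: "space \<tau> = space T" using sets_tau by (rule sets_eq_imp_space_eq)
  have ne: "space S \<noteq> {}" using subprob_not_empty f(2) space_tau by auto
  obtain \<G> where G: "countable \<G>" "\<G> \<subseteq> sets S" "sets S = sigma_sets (space S) \<G>"
    using standard_borel_separating[OF assms(1)] by metis
  obtain \<O> where O: "countable \<O>" "\<O> \<subseteq> sets T"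
    "\<And>t t'. t \<in> space T \<Longrightarrow> t' \<in> space T \<Longrightarrow> t \<noteq> t' \<Longrightarrow> \<exists>B\<in>\<O>. t \<in> B \<and> t' \<notin> B"
    using standard_borel_separating[OF assms(2)] by metis
  obtain X where X: "completely_metrizable_space X" "separable_space X"
      "topspace X = space S" "sets S = sigma_sets (topspace X) {U. openin X U}"
    using assms(1) unfolding standard_borel_def by blast
  \<comment> \<open>Including \<open>{}\<close> guarantees that \<open>\<U>\<close> is
    nonempty.\<close>
  let ?\<B> = "insert {} (\<G> \<union> (\<lambda>B. f -` B \<inter> space S) ` \<O>)"
  have "countable ?\<B>" using G(1) O(1) by simp
  moreover have "?\<B> \<subseteq> sigma_sets (topspace X) {U. openin X U}"
    unfolding X(4)[symmetric] using G(2) O(2) measurable_sets[OF f(1)] by auto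
  ultimately obtain \<U> where U: "complete_covers (space S) \<U>"
      "\<And>B. B \<in> ?\<B> \<Longrightarrow> \<exists>U\<in>\<U>. decides (space S) U B"
    using borel_complete_covers[OF X(1,2)] unfolding X(3) by metis
  obtain g where g: "g \<in> \<tau> \<rightarrow>\<^sub>M S" "AE t in \<tau>. f (g t) = t"
  proof (rule AE_measurable_section[where S = S and \<tau> = \<tau> and f = f and \<U> = \<U> and \<G> = \<G> and \<O> = \<O>])
    show "finite_measure \<tau>" by unfold_locales
    show "\<U> \<noteq> {}" using U(2)[of "{}"] by blast
    show "\<G> \<subseteq> Pow (space S)" using G(2) sets.space_closed by blast
  qed (use ne f(2) space_tau sets_tau U G O in auto)
  show thesis
  proof (rule that[of "distr \<tau> S g"])
    show "distr \<tau> S g \<in> space (subprob_algebra S)"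
      using subprob_space_distr[OF g(1) ne] by (simp add: space_subprob_algebra)
    have "distr (distr \<tau> S g) T f = distr \<tau> T (f \<circ> g)" by (rule distr_distr[OF f(1) g(1)])
    also have "\<dots> = distr \<tau> \<tau> (\<lambda>t. t)"
      by (rule distr_cong_AE) (use sets_tau g f(1) measurable_comp[OF g(1) f(1)] in auto)
    also have "\<dots> = \<tau>" by simp
    finally show "distr (distr \<tau> S g) T f = \<tau>" .
  qed
qed

section \<open>The bisimulation on the direct sum\<close>

lemma measurable_case_sum:
  assumes "g \<in> S \<rightarrow>\<^sub>M N" "h \<in> T \<rightarrow>\<^sub>M N"
  shows "case_sum g h \<in> sum_space S T \<rightarrow>\<^sub>M N"
proof (rule measurableI)
  show "case_sum g h x \<in> space N" if "x \<in> space (sum_space S T)" for x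
    using that measurable_space[OF assms(1)] measurable_space[OF assms(2)]
    by (auto simp: space_sum_space)
  fix B assume B: "B \<in> sets N"
  have "Inl -` (case_sum g h -` B \<inter> space (sum_space S T)) = g -` B \<inter> space S"
    "Inr -` (case_sum g h -` B \<inter> space (sum_space S T)) = h -` B \<inter> space T"
    by (auto simp: space_sum_space)
  then show "case_sum g h -` B \<inter> space (sum_space S T) \<in> sets (sum_space S T)"
    using measurable_sets[OF assms(1) B] measurable_sets[OF assms(2) B]
    unfolding sets_sum_space_iff by simp
qed

theorem theorem4p5:
  fixes S :: "'a measure" and T :: "'b measure"
    and P :: "'a \<Rightarrow> 'a measure set set" and Q :: "'b \<Rightarrow> 'b measure set set"
    and f :: "'a \<Rightarrow> 'b"
  defines "G \<equiv> {(Inl s, Inr (f s)) | s. s \<in> space S}"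
  assumes "standard_borel S" and "standard_borel T"
    and "stochastic_effectivity S P" and "stochastic_effectivity T Q"
    and "strong_morphism S P T Q f"
  shows "state_bisimulation (sum_space S T) (direct_sum S P T Q) (G \<union> G\<inverse>)"
proof -
  let ?Z = "sum_space S T" and ?R = "G \<union> G\<inverse>"
  let ?h = "case_sum f (\<lambda>t. t)"
  have f: "f \<in> S \<rightarrow>\<^sub>M T" "f ` space S = space T"
    and strong: "\<And>s A. s \<in> space S \<Longrightarrow> A \<in> sets (subprob_algebra S) \<Longrightarrow> A \<in> P s \<longleftrightarrow>
      (\<exists>B \<in> Q (f s). (\<lambda>\<mu>. distr \<mu> T f) -` B \<inter> space (subprob_algebra S) \<subseteq> A)"
    using assms(6) unfolding strong_morphism_def by blast+
  have P: "\<And>s. s \<in> space S \<Longrightarrow> P s \<subseteq> sets (subprob_algebra S)"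
    and Q: "\<And>t. t \<in> space T \<Longrightarrow> Q t \<subseteq> sets (subprob_algebra T)"
    using assms(4,5) unfolding stochastic_effectivity_def by simp_all
  have fs: "f s \<in> space T" if "s \<in> space S" for s using measurable_space[OF f(1) that] .
  have h: "?h \<in> ?Z \<rightarrow>\<^sub>M T" using f(1) by (rule measurable_case_sum) simp
  have Inl_h: "distr (distr \<sigma> ?Z Inl) T ?h = distr \<sigma> T f" if "\<sigma> \<in> space (subprob_algebra S)" for \<sigma>
  proof -
    have "sets \<sigma> = sets S" using that by (simp add: space_subprob_algebra)
    then have "Inl \<in> \<sigma> \<rightarrow>\<^sub>M ?Z" using measurable_Inl_sum_space measurable_cong_sets by blast
    then show ?thesis using distr_distr[OF h, of Inl \<sigma>] by (simp add: comp_def)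
  qed
  have Inr_h: "distr (distr \<tau> ?Z Inr) T ?h = \<tau>" if "\<tau> \<in> space (subprob_algebra T)" for \<tau>
  proof -
    have s: "sets \<tau> = sets T" using that by (simp add: space_subprob_algebra)
    then have "Inr \<in> \<tau> \<rightarrow>\<^sub>M ?Z" using measurable_Inr_sum_space measurable_cong_sets by blast
    then show ?thesis using distr_distr[OF h, of Inr \<tau>] s by (simp add: comp_def distr_id2)
  qed
  have lift: "rel_lift ?Z ?R \<mu> \<nu>"
    if \<mu>: "\<mu> \<in> space (subprob_algebra ?Z)" and \<nu>: "\<nu> \<in> space (subprob_algebra ?Z)"
      and eq: "distr \<mu> T ?h = distr \<nu> T ?h" for \<mu> \<nu>
    unfolding rel_lift_def
  proof (intro ballI impI)
    fix C assume C: "C \<in> sets ?Z" "rel_closed ?R C"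
    then have CT: "Inr -` C \<in> sets T" by (simp add: sets_sum_space_iff)
    have "(Inl s, Inr (f s)) \<in> ?R" "(Inr (f s), Inl s) \<in> ?R" if "s \<in> space S" for s
      using that unfolding G_def by auto
    then have "Inl s \<in> C \<longleftrightarrow> Inr (f s) \<in> C" if "s \<in> space S" for s
      using C(2)[unfolded rel_closed_def, rule_format] that by metis
    \<comment> \<open>A closed set is thus determined by its part in \<open>T\<close>, where
      \<open>?h\<close> is the identity.\<close>
    then have "C = ?h -` (Inr -` C) \<inter> space ?Z"
      using sets.sets_into_space[OF C(1)] by (auto simp: space_sum_space split: sum.splits)
    moreover have "emeasure (distr \<rho> T ?h) (Inr -` C) = emeasure \<rho> (?h -` (Inr -` C) \<inter> space ?Z)"
      if \<rho>: "\<rho> \<in> space (subprob_algebra ?Z)" for \<rho>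
    proof -
      have s: "sets \<rho> = sets ?Z" using \<rho> by (simp add: space_subprob_algebra)
      then have "?h \<in> \<rho> \<rightarrow>\<^sub>M T" using h measurable_cong_sets by blast
      from emeasure_distr[OF this CT] show ?thesis using sets_eq_imp_space_eq[OF s] by simp
    qed
    ultimately show "emeasure \<mu> C = emeasure \<nu> C" using \<mu> \<nu> eq by metis
  qed
  have pull: "(\<lambda>\<nu>. distr \<nu> T ?h) -` B \<inter> space (subprob_algebra ?Z) \<in> sets (subprob_algebra ?Z)"
    if "B \<in> sets (subprob_algebra T)" for B
    using measurable_sets[OF measurable_distr[OF h] that] .
  have forward: "\<exists>B\<in>direct_sum S P T Q (Inr (f s)). \<forall>\<nu>\<in>B. \<exists>\<mu>\<in>A. rel_lift ?Z ?R \<mu> \<nu>"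
    if s: "s \<in> space S" and A: "A \<in> direct_sum S P T Q (Inl s)" for s A
  proof -
    have "\<exists>D\<in>P s. (\<lambda>\<mu>. distr \<mu> ?Z Inl) ` D \<subseteq> A"
      using A unfolding direct_sum_def by simp
    then obtain D where D: "D \<in> P s" "(\<lambda>\<mu>. distr \<mu> ?Z Inl) ` D \<subseteq> A" by blast
    then obtain E where E: "E \<in> Q (f s)" "(\<lambda>\<mu>. distr \<mu> T f) -` E \<inter> space (subprob_algebra S) \<subseteq> D"
      using strong[OF s] P[OF s] by blast
    have E_sets: "E \<in> sets (subprob_algebra T)" using Q[OF fs[OF s]] E by blast
    \<comment> \<open>Members of \<open>?B\<close> may charge both summands; only their images under
      \<open>?h\<close> are constrained.\<close>
    let ?B = "(\<lambda>\<nu>. distr \<nu> T ?h) -` E \<inter> space (subprob_algebra ?Z)"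
    have "(\<lambda>\<mu>. distr \<mu> ?Z Inr) ` E \<subseteq> ?B"
      using sets.sets_into_space[OF E_sets] Inr_h
        measurable_space[OF measurable_distr[OF measurable_Inr_sum_space[of T S]]] by auto
    then have "?B \<in> direct_sum S P T Q (Inr (f s))"
      using pull[OF E_sets] E(1) unfolding direct_sum_def by auto
    moreover have "\<exists>\<mu>\<in>A. rel_lift ?Z ?R \<mu> \<nu>" if \<nu>: "\<nu> \<in> ?B" for \<nu>
    proof -
      \<comment> \<open>The image of \<open>\<nu>\<close> lies in \<open>E\<close>, so any preimage
        \<open>\<sigma>\<close> of it under the image map of \<open>f\<close> lies in
        \<open>D\<close> by the choice of \<open>E\<close>.\<close>
      have "distr \<nu> T ?h \<in> space (subprob_algebra T)"
        using \<nu> sets.sets_into_space[OF E_sets] by auto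
      then obtain \<sigma> where \<sigma>: "\<sigma> \<in> space (subprob_algebra S)" "distr \<sigma> T f = distr \<nu> T ?h"
        using subprob_distr_surjective[OF assms(2,3) f] by metis
      have "\<sigma> \<in> D" using \<sigma> \<nu> E(2) by auto
      moreover have "rel_lift ?Z ?R (distr \<sigma> ?Z Inl) \<nu>"
        by (rule lift) (use \<nu> \<sigma> Inl_h
          measurable_space[OF measurable_distr[OF measurable_Inl_sum_space[of S T]]] in auto)
      ultimately show ?thesis using D(2) by blast
    qed
    ultimately show ?thesis by blast
  qed
  have backward: "\<exists>B\<in>direct_sum S P T Q (Inl s). \<forall>\<nu>\<in>B. \<exists>\<mu>\<in>A. rel_lift ?Z ?R \<mu> \<nu>"
    if s: "s \<in> space S" and A: "A \<in> direct_sum S P T Q (Inr (f s))" for s A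
  proof -
    have "\<exists>D\<in>Q (f s). (\<lambda>\<mu>. distr \<mu> ?Z Inr) ` D \<subseteq> A"
      using A unfolding direct_sum_def by simp
    then obtain D where D: "D \<in> Q (f s)" "(\<lambda>\<mu>. distr \<mu> ?Z Inr) ` D \<subseteq> A" by blast
    have D_sets: "D \<in> sets (subprob_algebra T)" using Q[OF fs[OF s]] D by blast
    let ?E = "(\<lambda>\<mu>. distr \<mu> T f) -` D \<inter> space (subprob_algebra S)"
    \<comment> \<open>The strong morphism condition holds with \<open>D\<close> itself as
      witness.\<close>
    have "?E \<in> P s"
      using strong[OF s measurable_sets[OF measurable_distr[OF f(1)] D_sets]] D(1) by blast
    let ?B = "(\<lambda>\<nu>. distr \<nu> T ?h) -` D \<inter> space (subprob_algebra ?Z)"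
    have "(\<lambda>\<mu>. distr \<mu> ?Z Inl) ` ?E \<subseteq> ?B"
      using Inl_h measurable_space[OF measurable_distr[OF measurable_Inl_sum_space[of S T]]] by auto
    then have "?B \<in> direct_sum S P T Q (Inl s)"
      using pull[OF D_sets] \<open>?E \<in> P s\<close> unfolding direct_sum_def by auto
    moreover have "\<exists>\<mu>\<in>A. rel_lift ?Z ?R \<mu> \<nu>" if \<nu>: "\<nu> \<in> ?B" for \<nu>
    proof -
      have \<tau>: "distr \<nu> T ?h \<in> D" "distr \<nu> T ?h \<in> space (subprob_algebra T)"
        using \<nu> sets.sets_into_space[OF D_sets] by auto
      \<comment> \<open>In this direction the image of \<open>\<nu>\<close> on \<open>T\<close> is
        already in \<open>D\<close>, and placing it on the second summand leaves its image under
        \<open>?h\<close> unchanged.\<close>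
      have "rel_lift ?Z ?R (distr (distr \<nu> T ?h) ?Z Inr) \<nu>"
        by (rule lift) (use \<nu> \<tau> Inr_h
          measurable_space[OF measurable_distr[OF measurable_Inr_sum_space[of T S]]] in auto)
      then show ?thesis using D(2) \<tau>(1) by blast
    qed
    ultimately show ?thesis by blast
  qed
  show ?thesis
    unfolding state_bisimulation_def
  proof (intro conjI)
    show "?R \<subseteq> space ?Z \<times> space ?Z" unfolding G_def using fs by (auto simp: space_sum_space)
    show "sym ?R" by (rule sym_Un_converse)
    show "\<forall>(s, t)\<in>?R. \<forall>A\<in>direct_sum S P T Q s. \<exists>B\<in>direct_sum S P T Q t.
        \<forall>\<nu>\<in>B. \<exists>\<mu>\<in>A. rel_lift ?Z ?R \<mu> \<nu>"
    proof clarify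
      fix x y A assume xy: "(x, y) \<in> ?R" and A: "A \<in> direct_sum S P T Q x"
      then consider s where "s \<in> space S" "x = Inl s" "y = Inr (f s)"
        | s where "s \<in> space S" "x = Inr (f s)" "y = Inl s"
        unfolding G_def by blast
      then show "\<exists>B\<in>direct_sum S P T Q y. \<forall>\<nu>\<in>B. \<exists>\<mu>\<in>A. rel_lift ?Z ?R \<mu> \<nu>"
        by cases (use forward backward A in simp_all)
    qed
  qed
qed

end
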